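(* Let $h:\mathbb{R}^d\to\mathbb{R}$ be $\mu_h$-PŁ with $L_h$-Lipschitz gradient, and let $\{x^k\}$ be the sequence generated by AC-GM (described in the context) with scale parameter $\alpha>1$ and initial Lipschitz factor $L_0>0$. Then for every generated iterate $x^{k+1}$, $k\ge0$, $$h(x^{k+1})-h^*\le C_h(1-p)^{k+1}\big(h(x^0)-h^*\big),\qquad p:=\frac{\mu_h(\alpha-1)}{2\alpha^2\max\{L_0,L_h\}},$$ where $0<p<1$ and $$C_h:=\frac{(1+\bar C)^{m_h}}{(1-p)^{m_h}},\quad \bar C:=\max\left\{\frac{L_h^3}{\mu_h\alpha^2L_0^2},\frac{L_h^2}{\mu_h\alpha^2L_0},\frac{\mu_hL_h}{\alpha^2L_0^2},\frac{\mu_h}{\alpha^2L_0}\right\},\quad m_h:=\left\lceil\log_\beta\frac{\max\{L_0,L_h\}}{L_0}\right\rceil_+,\quad \beta:=\frac{\alpha+1}{2}.$$ Furthermore, the optimal convergence factor (i.e. the smallest value of $1-p$ over $\alpha>1$) is achieved at $\alpha=2$, for which $$h(x^{k+1})-h^*\le C_h\left(1-\frac{\mu_h}{8\max\{L_0,L_h\}}\right)^{k+1}\big(h(x^0)-h^*\big).$$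
   Context: PŁ condition: $h:\mathbb{R}^d\to\mathbb{R}$ with (attained) minimum value $h^*=\min h$ is $\mu_h$-PŁ ($\mu_h>0$) if $2\mu_h(h(x)-h^* )\le\|\nabla h(x)\|^2$ for all $x$. $\lceil a\rceil_+$ denotes the smallest nonnegative integer greater than or equal to $a$. $\text{AC-GM}(h,x^0,\alpha,L_0,\epsilon_h)$: given $x^0\in\mathbb{R}^d$, $\alpha>1$, $L_0>0$, $\epsilon_h>0$, start with $k=0$; while $\|\nabla h(x^k)\|>\epsilon_h$, set $\gamma_{k+1}=\max\{L_0,\dots,L_k\}$, $x^{k+1}=x^k-\frac{1}{\alpha\gamma_{k+1}}\nabla h(x^k)$, $L_{k+1}=\frac{2(h(x^{k+1})-h(x^k)-\langle\nabla h(x^k),x^{k+1}-x^k\rangle)}{\|x^{k+1}-x^k\|^2}$, $k\leftarrow k+1$.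
   Formalization: The claim p < 1 is stated only for non-constant h; for constant h every μ_h > 0 satisfies the PŁ condition, so p < 1 can fail (then no iterate x^{k+1} is generated). *)

theory Defs
  imports "HOL-Analysis.Analysis"
begin

(* Meaningful only where h is differentiable; uniqueness of D is then automatic. *)
definition grad :: "('a::real_inner \<Rightarrow> real) \<Rightarrow> 'a \<Rightarrow> 'a" where
  "grad h x = (THE D. GDERIV h x :> D)"

definition min_value :: "('a \<Rightarrow> real) \<Rightarrow> real" where
  "min_value h = (LEAST v. v \<in> range h)"

definition PL_condition :: "real \<Rightarrow> ('a::real_inner \<Rightarrow> real) \<Rightarrow> bool" where
  "PL_condition \<mu> h \<longleftrightarrow>
     \<mu> > 0 \<and> (\<exists>z. \<forall>y. h z \<le> h y) \<and>
     (\<forall>x. 2 * \<mu> * (h x - min_value h) \<le> (norm (grad h x))\<^sup>2)"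

definition lipschitz_gradient :: "real \<Rightarrow> ('a::real_inner \<Rightarrow> real) \<Rightarrow> bool" where
  "lipschitz_gradient L h \<longleftrightarrow>
     (\<forall>x. h differentiable at x) \<and> L-lipschitz_on UNIV (grad h)"

(* State of AC-GM after k passes through the loop: the iterate x^k together with the list
   [L_0, ..., L_k].  The value None means that the loop stopped before producing x^k. *)
primrec acgm_state ::
  "('a::real_inner \<Rightarrow> real) \<Rightarrow> 'a \<Rightarrow> real \<Rightarrow> real \<Rightarrow> real \<Rightarrow> nat \<Rightarrow> ('a \<times> real list) option" where
  "acgm_state h x0 \<alpha> L0 \<epsilon> 0 = Some (x0, [L0])"
| "acgm_state h x0 \<alpha> L0 \<epsilon> (Suc k) =
     (case acgm_state h x0 \<alpha> L0 \<epsilon> k of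
        None \<Rightarrow> None
      | Some (x, Ls) \<Rightarrow>
          if norm (grad h x) > \<epsilon> then
            (let \<gamma> = Max (set Ls);
                 x' = x - (1 / (\<alpha> * \<gamma>)) *\<^sub>R grad h x;
                 L' = 2 * (h x' - h x - grad h x \<bullet> (x' - x)) / (norm (x' - x))\<^sup>2
             in Some (x', Ls @ [L']))
          else None)"

definition acgm_iterate ::
  "('a::real_inner \<Rightarrow> real) \<Rightarrow> 'a \<Rightarrow> real \<Rightarrow> real \<Rightarrow> real \<Rightarrow> nat \<Rightarrow> 'a option" where
  "acgm_iterate h x0 \<alpha> L0 \<epsilon> k = map_option fst (acgm_state h x0 \<alpha> L0 \<epsilon> k)"

definition acgm_p :: "real \<Rightarrow> real \<Rightarrow> real \<Rightarrow> real \<Rightarrow> real" where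
  "acgm_p \<mu> L\<^sub>h L0 \<alpha> = \<mu> * (\<alpha> - 1) / (2 * \<alpha>\<^sup>2 * max L0 L\<^sub>h)"

definition acgm_Cbar :: "real \<Rightarrow> real \<Rightarrow> real \<Rightarrow> real \<Rightarrow> real" where
  "acgm_Cbar \<mu> L\<^sub>h L0 \<alpha> =
     Max {L\<^sub>h ^ 3 / (\<mu> * \<alpha>\<^sup>2 * L0\<^sup>2), L\<^sub>h\<^sup>2 / (\<mu> * \<alpha>\<^sup>2 * L0),
          \<mu> * L\<^sub>h / (\<alpha>\<^sup>2 * L0\<^sup>2), \<mu> / (\<alpha>\<^sup>2 * L0)}"

(* nat sends negative integers to 0, so nat (ceiling a) is the smallest
   nonnegative integer that is at least a. *)
definition acgm_m :: "real \<Rightarrow> real \<Rightarrow> real \<Rightarrow> nat" where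
  "acgm_m L\<^sub>h L0 \<alpha> = nat \<lceil>log ((\<alpha> + 1) / 2) (max L0 L\<^sub>h / L0)\<rceil>"

definition acgm_C :: "real \<Rightarrow> real \<Rightarrow> real \<Rightarrow> real \<Rightarrow> real" where
  "acgm_C \<mu> L\<^sub>h L0 \<alpha> =
     (1 + acgm_Cbar \<mu> L\<^sub>h L0 \<alpha>) ^ acgm_m L\<^sub>h L0 \<alpha> / (1 - acgm_p \<mu> L\<^sub>h L0 \<alpha>) ^ acgm_m L\<^sub>h L0 \<alpha>"

end

theory Submission
  imports Defs
begin

text \<open>
  By definition of \<open>L\<^sub>k\<^sub>+\<^sub>1\<close>, a step satisfies
  \<open>h x\<^sub>k\<^sub>+\<^sub>1 = h x\<^sub>k - (1 - L\<^sub>k\<^sub>+\<^sub>1 / (2 \<alpha> \<gamma>)) \<parallel>\<nabla>h x\<^sub>k\<parallel>\<^sup>2 / (\<alpha> \<gamma>)\<close> exactly, where \<open>\<gamma> = \<gamma>\<^sub>k\<^sub>+\<^sub>1\<close>.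
  If \<open>L\<^sub>k\<^sub>+\<^sub>1 \<le> \<beta> \<gamma>\<close>, the PL inequality turns this into a contraction of the
  gap by \<open>1 - p\<close>.  Otherwise the gap grows by at most the factor \<open>1 + C\<close>, but the running
  maximum of the estimates is multiplied by more than \<open>\<beta>\<close>; as all estimates
  are at most \<open>max L\<^sub>0 L\<^sub>h\<close>, this happens at most \<open>m\<close> times.
\<close>

section \<open>Gradients and the descent lemma\<close>

text \<open>\<open>grad\<close> is a definite description, so a representing vector must exist and
  be unique: the adjoint of the derivative, applied to 1, gives it, and testing on
  \<open>E - D\<close> gives uniqueness.\<close>

lemma has_derivative_grad:
  fixes h :: "'a::euclidean_space \<Rightarrow> real"
  assumes "h differentiable at x"
  shows "(h has_derivative (\<lambda>v. grad h x \<bullet> v)) (at x)"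
proof -
  obtain f where f: "(h has_derivative f) (at x)"
    using assms by (auto simp: differentiable_def)
  have lin: "linear f"
    using f by (rule has_derivative_linear)
  define D where "D = adjoint f 1"
  have "f = (\<lambda>v. D \<bullet> v)"
    using adjoint_works[OF lin, of _ 1] by (auto simp: D_def inner_commute)
  then have D: "GDERIV h x :> D"
    using f by (simp add: gderiv_def inner_commute)
  moreover have "E = D" if "GDERIV h x :> E" for E
  proof -
    have "(\<lambda>v. v \<bullet> E) = (\<lambda>v. v \<bullet> D)"
      using that D unfolding gderiv_def by (rule has_derivative_unique)
    then have "(E - D) \<bullet> E = (E - D) \<bullet> D"
      by (rule fun_cong)
    then show ?thesis
      by (metis inner_diff_right inner_eq_zero_iff right_minus_eq)
  qed
  ultimately have "GDERIV h x :> grad h x"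
    unfolding grad_def by (rule theI)
  then show ?thesis
    by (simp add: gderiv_def inner_commute)
qed

lemma lipschitz_gradient_nonneg: "lipschitz_gradient L h \<Longrightarrow> 0 \<le> L"
  by (auto simp: lipschitz_gradient_def dest: lipschitz_on_nonneg)

text \<open>Along the segment from \<open>x\<close> to \<open>y\<close>, \<open>h\<close> minus its
  quadratic upper model has nonpositive derivative, by Cauchy-Schwarz and the Lipschitz
  bound.\<close>

lemma descent_lemma:
  fixes h :: "'a::euclidean_space \<Rightarrow> real"
  assumes "lipschitz_gradient L h"
  shows "h y \<le> h x + grad h x \<bullet> (y - x) + L / 2 * (norm (y - x))\<^sup>2"
proof -
  define d where "d = y - x"
  define \<phi> where "\<phi> t = h (x + t *\<^sub>R d) - t * (grad h x \<bullet> d) - L / 2 * t\<^sup>2 * (norm d)\<^sup>2" for t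
  have "\<phi> 1 \<le> \<phi> 0"
  proof (rule DERIV_nonpos_imp_nonincreasing[where f = \<phi>])
    fix t :: real
    assume t: "0 \<le> t" "t \<le> 1"
    have "(h has_derivative (\<lambda>v. grad h (x + t *\<^sub>R d) \<bullet> v)) (at (x + t *\<^sub>R d))"
      using assms by (intro has_derivative_grad) (simp add: lipschitz_gradient_def)
    moreover have "((\<lambda>t. x + t *\<^sub>R d) has_derivative (\<lambda>s. s *\<^sub>R d)) (at t)"
      by (auto intro!: derivative_eq_intros)
    ultimately have "((\<lambda>t. h (x + t *\<^sub>R d)) has_derivative
        (\<lambda>s. grad h (x + t *\<^sub>R d) \<bullet> (s *\<^sub>R d))) (at t)"
      by (rule has_derivative_compose[rotated])
    then have "((\<lambda>t. h (x + t *\<^sub>R d)) has_real_derivative grad h (x + t *\<^sub>R d) \<bullet> d) (at t)"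
      by (rule has_derivative_imp_has_field_derivative) simp
    then have der: "(\<phi> has_real_derivative
        grad h (x + t *\<^sub>R d) \<bullet> d - grad h x \<bullet> d - L * t * (norm d)\<^sup>2) (at t)"
      unfolding \<phi>_def by (auto intro!: derivative_eq_intros)
    have "norm (grad h (x + t *\<^sub>R d) - grad h x) \<le> L * norm (t *\<^sub>R d)"
      using assms lipschitz_on_normD[of L UNIV "grad h" "x + t *\<^sub>R d" x]
      by (simp add: lipschitz_gradient_def)
    then have "norm (grad h (x + t *\<^sub>R d) - grad h x) * norm d \<le> L * norm (t *\<^sub>R d) * norm d"
      by (rule mult_right_mono) simp
    moreover have "(grad h (x + t *\<^sub>R d) - grad h x) \<bullet> d
        \<le> norm (grad h (x + t *\<^sub>R d) - grad h x) * norm d"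
      by (rule norm_cauchy_schwarz)
    ultimately have "grad h (x + t *\<^sub>R d) \<bullet> d - grad h x \<bullet> d - L * t * (norm d)\<^sup>2 \<le> 0"
      using t by (simp add: inner_diff_left power2_eq_square mult.assoc)
    with der show "\<exists>y. (\<phi> has_real_derivative y) (at t) \<and> y \<le> 0"
      by blast
  qed simp
  then show ?thesis
    by (simp add: \<phi>_def d_def)
qed

section \<open>The minimum value and consequences of the PL inequality\<close>

text \<open>\<open>LEAST\<close> over the reals is a minimum only if one is attained; the minimiser
  \<open>z\<close> supplies it.\<close>

lemma min_value_le:
  assumes "\<forall>y. h z \<le> h y"
  shows "min_value h \<le> h x"
proof -
  have "min_value h = h z"
    unfolding min_value_def using assms by (intro Least_equality) auto
  with assms show ?thesis
    by simp
qed

lemma PL_min_value_le: "PL_condition \<mu> h \<Longrightarrow> min_value h \<le> h x"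
  by (auto simp: PL_condition_def intro: min_value_le)

text \<open>The minimum lies below the value after a gradient step of size 1/L, which the descent
  lemma bounds.\<close>

lemma norm_grad_le:
  fixes h :: "'a::euclidean_space \<Rightarrow> real"
  assumes "PL_condition \<mu> h" "lipschitz_gradient L h"
  shows "(norm (grad h x))\<^sup>2 \<le> 2 * L * (h x - min_value h)"
proof (cases "L = 0")
  case True
  \<comment> \<open>Without the quadratic term, arbitrarily long steps along the negative gradient
    are allowed; this forces the gradient to vanish.\<close>
  have le: "s * (norm (grad h x))\<^sup>2 \<le> h x - min_value h" for s
    using PL_min_value_le[OF assms(1), of "x - s *\<^sub>R grad h x"] True
      descent_lemma[OF assms(2), of "x - s *\<^sub>R grad h x" x]
    by (simp add: power2_norm_eq_inner)
  have "(norm (grad h x))\<^sup>2 = 0"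
  proof (rule ccontr)
    assume "(norm (grad h x))\<^sup>2 \<noteq> 0"
    then show False
      using le[of "(h x - min_value h + 1) / (norm (grad h x))\<^sup>2"] by simp
  qed
  with True show ?thesis
    by simp
next
  case False
  then have L: "L > 0"
    using lipschitz_gradient_nonneg[OF assms(2)] by simp
  have "min_value h \<le> h (x - (1 / L) *\<^sub>R grad h x)"
    using assms(1) by (rule PL_min_value_le)
  also have "\<dots> \<le> h x - (norm (grad h x))\<^sup>2 / (2 * L)"
    using descent_lemma[OF assms(2), of "x - (1 / L) *\<^sub>R grad h x" x] L
    by (simp add: power2_norm_eq_inner[symmetric] power_mult_distrib power_divide)
      (simp add: field_simps power2_eq_square)
  finally show ?thesis
    using L by (simp add: field_simps)
qed

text \<open>The squared gradient norm is bounded on both sides by multiples of the gap, and a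
  positive gap cancels. For constant \<open>h\<close> the PL condition holds with every positive
  \<mu>, hence the third assumption.\<close>

lemma PL_constant_le:
  fixes h :: "'a::euclidean_space \<Rightarrow> real"
  assumes PL: "PL_condition \<mu> h" and lip: "lipschitz_gradient L h"
    and "h x \<noteq> min_value h"
  shows "\<mu> \<le> L"
proof -
  have "2 * \<mu> * (h x - min_value h) \<le> 2 * L * (h x - min_value h)"
    using PL norm_grad_le[OF PL lip, of x] unfolding PL_condition_def by (meson order_trans)
  moreover have "h x - min_value h > 0"
    using PL_min_value_le[OF PL, of x] assms(3) by simp
  ultimately show ?thesis
    by simp
qed

section \<open>The constants of the rate\<close>

text \<open>Equivalent to (\<alpha> - 2)^2 \<ge> 0, with equality at 2: this is the source of the
  optimal scale parameter.\<close>

lemma step_factor_le: "(\<alpha> - 1) / \<alpha>\<^sup>2 \<le> 1 / 4" if "\<alpha> > 0" for \<alpha> :: real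
proof -
  have "0 \<le> (\<alpha> - 2)\<^sup>2"
    by simp
  then show ?thesis
    using that by (simp add: field_simps power2_eq_square)
qed

lemma acgm_p_eq: "acgm_p \<mu> L\<^sub>h L0 \<alpha> = (\<alpha> - 1) / \<alpha>\<^sup>2 * (\<mu> / (2 * max L0 L\<^sub>h))"
  by (simp add: acgm_p_def mult_ac)

lemma acgm_p_pos:
  assumes "\<mu> > 0" "L0 > 0" "\<alpha> > 1"
  shows "0 < acgm_p \<mu> L\<^sub>h L0 \<alpha>"
  unfolding acgm_p_def using assms by (intro divide_pos_pos mult_pos_pos) auto

lemma acgm_p_le:
  assumes "\<mu> > 0" "L0 > 0" "\<alpha> > 0"
  shows "acgm_p \<mu> L\<^sub>h L0 \<alpha> \<le> acgm_p \<mu> L\<^sub>h L0 2"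
  unfolding acgm_p_eq using assms step_factor_le[of \<alpha>] by (intro mult_right_mono) auto

lemma acgm_p_2: "acgm_p \<mu> L\<^sub>h L0 2 = \<mu> / (8 * max L0 L\<^sub>h)"
  by (simp add: acgm_p_def)

text \<open>At \<alpha> = 2 the value is at most 1/8, since \<mu> is at most
  \<open>L\<^sub>h\<close>; every other \<alpha> gives no more.\<close>

lemma acgm_p_less_1:
  assumes "\<mu> > 0" "L0 > 0" "\<alpha> > 0" "\<mu> \<le> L\<^sub>h"
  shows "acgm_p \<mu> L\<^sub>h L0 \<alpha> < 1"
proof -
  have "acgm_p \<mu> L\<^sub>h L0 2 < 1"
    using assms by (simp add: acgm_p_2 divide_less_eq)
  then show ?thesis
    using acgm_p_le[OF assms(1-3), of L\<^sub>h] by simp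
qed

text \<open>The left side is the relative growth that arises in \<open>bad_step\<close>; the first
  entry of the maximum dominates it once a factor \<mu> is traded for
  \<open>L\<^sub>h\<close>.\<close>

lemma acgm_Cbar_ge:
  assumes "\<mu> > 0" "L0 > 0" "\<alpha> > 1" "\<mu> \<le> L\<^sub>h"
  shows "L\<^sub>h\<^sup>2 / (\<alpha>\<^sup>2 * L0\<^sup>2) \<le> acgm_Cbar \<mu> L\<^sub>h L0 \<alpha>"
proof -
  have "L\<^sub>h\<^sup>2 / (\<alpha>\<^sup>2 * L0\<^sup>2) = \<mu> * L\<^sub>h\<^sup>2 / (\<mu> * \<alpha>\<^sup>2 * L0\<^sup>2)"
    using assms by simp
  also have "\<dots> \<le> L\<^sub>h ^ 3 / (\<mu> * \<alpha>\<^sup>2 * L0\<^sup>2)"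
    using assms by (intro divide_right_mono) (auto simp: power3_eq_cube power2_eq_square)
  also have "\<dots> \<le> acgm_Cbar \<mu> L\<^sub>h L0 \<alpha>"
    unfolding acgm_Cbar_def by (intro Max_ge) auto
  finally show ?thesis .
qed

section \<open>One pass of the loop, from \<open>x\<close> to \<open>x'\<close>\<close>

context
  fixes h :: "'a::euclidean_space \<Rightarrow> real" and x x' :: 'a and \<alpha> \<gamma> L' :: real
  assumes \<alpha>: "\<alpha> > 1" and \<gamma>: "\<gamma> > 0" and g: "grad h x \<noteq> 0"
    and x': "x' = x - (1 / (\<alpha> * \<gamma>)) *\<^sub>R grad h x"
    and L': "L' = 2 * (h x' - h x - grad h x \<bullet> (x' - x)) / (norm (x' - x))\<^sup>2"
begin

text \<open>Guarantees that the quotient defining \<open>L'\<close> is genuine, since division by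
  zero would yield 0.\<close>

lemma gradient_step_norm_pos: "0 < (norm (x' - x))\<^sup>2"
  using \<alpha> \<gamma> g by (simp add: x')

lemma local_lipschitz_estimate_le:
  assumes "lipschitz_gradient L h"
  shows "L' \<le> L"
  using descent_lemma[OF assms, of x' x] gradient_step_norm_pos
  by (simp add: L' divide_le_eq)

lemma gradient_step_eq:
  "h x' = h x - (norm (grad h x))\<^sup>2 / (\<alpha> * \<gamma>) + L' * (norm (grad h x))\<^sup>2 / (2 * (\<alpha> * \<gamma>)\<^sup>2)"
proof -
  have "h x' = h x + grad h x \<bullet> (x' - x) + L' / 2 * (norm (x' - x))\<^sup>2"
    using gradient_step_norm_pos by (simp add: L') (simp add: field_simps)
  also have "grad h x \<bullet> (x' - x) = - (norm (grad h x))\<^sup>2 / (\<alpha> * \<gamma>)"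
    by (simp add: x' power2_norm_eq_inner)
  also have "(norm (x' - x))\<^sup>2 = (norm (grad h x))\<^sup>2 / (\<alpha> * \<gamma>)\<^sup>2"
    using \<alpha> \<gamma> by (simp add: x' power_mult_distrib power_divide)
  finally show ?thesis
    by simp
qed

lemma good_step:
  assumes PL: "PL_condition \<mu> h" and "L' \<le> (\<alpha> + 1) / 2 * \<gamma>" "\<gamma> \<le> max L0 L\<^sub>h"
  shows "h x' - min_value h \<le> (1 - acgm_p \<mu> L\<^sub>h L0 \<alpha>) * (h x - min_value h)"
proof -
  let ?G = "(norm (grad h x))\<^sup>2" and ?D = "h x - min_value h"
  have D: "?D \<ge> 0" and \<mu>: "\<mu> > 0" and G: "2 * \<mu> * ?D \<le> ?G"
    using PL PL_min_value_le[OF PL, of x] by (auto simp: PL_condition_def)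
  have "L' * ?G / (2 * (\<alpha> * \<gamma>)\<^sup>2) \<le> ((\<alpha> + 1) / 2 * \<gamma>) * ?G / (2 * (\<alpha> * \<gamma>)\<^sup>2)"
    using assms(2) by (intro divide_right_mono mult_right_mono) auto
  \<comment> \<open>Subtracting (\<alpha> + 1) / (4 \<alpha>^2 \<gamma>) from 1 / (\<alpha>
    \<gamma>) leaves the coefficient with 3 \<alpha> - 1.\<close>
  also have "\<dots> = ?G / (\<alpha> * \<gamma>) - (3 * \<alpha> - 1) / (4 * \<alpha>\<^sup>2 * \<gamma>) * ?G"
    using \<alpha> \<gamma> by (simp add: field_simps power2_eq_square)
  finally have "h x' \<le> h x - (3 * \<alpha> - 1) / (4 * \<alpha>\<^sup>2 * \<gamma>) * ?G"
    using gradient_step_eq by simp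
  moreover have "acgm_p \<mu> L\<^sub>h L0 \<alpha> * ?D \<le> (3 * \<alpha> - 1) / (4 * \<alpha>\<^sup>2 * \<gamma>) * ?G"
  proof -
    have "acgm_p \<mu> L\<^sub>h L0 \<alpha> \<le> \<mu> * (\<alpha> - 1) / (2 * \<alpha>\<^sup>2 * \<gamma>)"
      unfolding acgm_p_def using \<alpha> \<gamma> \<mu> assms(3)
      by (intro divide_left_mono mult_left_mono mult_pos_pos) auto
    \<comment> \<open>The decrease offers 3 \<alpha> - 1 where \<open>acgm_p\<close> has the smaller
      \<alpha> - 1.\<close>
    also have "\<dots> \<le> \<mu> * ((3 * \<alpha> - 1) / 2) / (\<alpha>\<^sup>2 * \<gamma>)"
      using \<alpha> \<gamma> \<mu> by (simp add: divide_le_eq)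
    finally have "acgm_p \<mu> L\<^sub>h L0 \<alpha> * ?D \<le> \<mu> * ((3 * \<alpha> - 1) / 2) / (\<alpha>\<^sup>2 * \<gamma>) * ?D"
      using D by (rule mult_right_mono)
    also have "\<dots> = (3 * \<alpha> - 1) / (4 * \<alpha>\<^sup>2 * \<gamma>) * (2 * \<mu> * ?D)"
      by simp (simp add: mult_ac)
    also have "\<dots> \<le> (3 * \<alpha> - 1) / (4 * \<alpha>\<^sup>2 * \<gamma>) * ?G"
      using G \<alpha> \<gamma> by (intro mult_left_mono) auto
    finally show ?thesis .
  qed
  ultimately show ?thesis
    by (simp add: algebra_simps)
qed

text \<open>The decrease term is dropped; what remains is bounded through \<open>L\<^sub>h\<close>,
  \<open>norm_grad_le\<close> and \<open>L0 \<le> \<gamma>\<close>.\<close>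

lemma bad_step:
  assumes PL: "PL_condition \<mu> h" and lip: "lipschitz_gradient L\<^sub>h h"
    and "\<mu> \<le> L\<^sub>h" and L0: "L0 > 0" "L0 \<le> \<gamma>"
  shows "h x' - min_value h \<le> (1 + acgm_Cbar \<mu> L\<^sub>h L0 \<alpha>) * (h x - min_value h)"
proof -
  let ?G = "(norm (grad h x))\<^sup>2" and ?D = "h x - min_value h"
  have D: "?D \<ge> 0" and \<mu>: "\<mu> > 0"
    using PL PL_min_value_le[OF PL, of x] by (auto simp: PL_condition_def)
  have "h x' \<le> h x + L' * ?G / (2 * (\<alpha> * \<gamma>)\<^sup>2)"
    using gradient_step_eq \<alpha> \<gamma> by simp
  \<comment> \<open>\<open>L'\<close> may be negative; monotonicity uses that its upper bound
    \<open>L\<^sub>h\<close> is nonnegative, as \<open>\<mu> \<le> L\<^sub>h\<close>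
    ensures.\<close>
  also have "L' * ?G / (2 * (\<alpha> * \<gamma>)\<^sup>2) \<le> L\<^sub>h * (2 * L\<^sub>h * ?D) / (2 * (\<alpha> * L0)\<^sup>2)"
    using local_lipschitz_estimate_le[OF lip] norm_grad_le[OF PL lip, of x] L0 \<alpha> \<mu> D assms(3)
    by (intro frac_le mult_mono power_mono) auto
  also have "\<dots> = L\<^sub>h\<^sup>2 / (\<alpha>\<^sup>2 * L0\<^sup>2) * ?D"
    by (simp add: power_mult_distrib power2_eq_square[of L\<^sub>h])
  also have "\<dots> \<le> acgm_Cbar \<mu> L\<^sub>h L0 \<alpha> * ?D"
    using acgm_Cbar_ge[OF \<mu> L0(1) \<alpha> assms(3)] D by (rule mult_right_mono)
  finally show ?thesis
    by (simp add: algebra_simps)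
qed

end

section \<open>Iterating the one-step bounds\<close>

text \<open>Here \<open>j\<close> counts the steps at which the running maximum grew by more than
  the factor \<open>\<beta> = (\<alpha> + 1) / 2\<close>.\<close>

lemma acgm_state_bound:
  fixes h :: "'a::euclidean_space \<Rightarrow> real"
  assumes PL: "PL_condition \<mu> h" and lip: "lipschitz_gradient L\<^sub>h h"
    and L0: "L0 > 0" and "\<epsilon> > 0" and \<alpha>: "\<alpha> > 1" and le: "\<mu> \<le> L\<^sub>h"
    and "acgm_state h x0 \<alpha> L0 \<epsilon> k = Some (x, Ls)"
  shows "Ls \<noteq> [] \<and> L0 \<in> set Ls \<and> Max (set Ls) \<le> max L0 L\<^sub>h \<and>
    (\<exists>j. ((\<alpha> + 1) / 2) ^ j * L0 \<le> Max (set Ls) \<and>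
      h x - min_value h \<le> ((1 + acgm_Cbar \<mu> L\<^sub>h L0 \<alpha>) / (1 - acgm_p \<mu> L\<^sub>h L0 \<alpha>)) ^ j
        * (1 - acgm_p \<mu> L\<^sub>h L0 \<alpha>) ^ k * (h x0 - min_value h))"
  using assms(7)
proof (induction k arbitrary: x Ls)
  case 0
  then show ?case
    by (auto intro!: exI[of _ 0])
next
  case (Suc k)
  let ?\<beta> = "(\<alpha> + 1) / 2" and ?p = "acgm_p \<mu> L\<^sub>h L0 \<alpha>" and ?C = "acgm_Cbar \<mu> L\<^sub>h L0 \<alpha>"
  let ?q = "(1 + ?C) / (1 - ?p)" and ?D0 = "h x0 - min_value h"
  obtain y Ms where st: "acgm_state h x0 \<alpha> L0 \<epsilon> k = Some (y, Ms)"
    using Suc.prems by (auto split: option.splits)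
  define \<gamma> where "\<gamma> = Max (set Ms)"
  define L' where "L' = 2 * (h x - h y - grad h y \<bullet> (x - y)) / (norm (x - y))\<^sup>2"
  have "norm (grad h y) > \<epsilon>" and x: "x = y - (1 / (\<alpha> * \<gamma>)) *\<^sub>R grad h y"
    and Ls: "Ls = Ms @ [L']"
    using Suc.prems st by (auto simp: \<gamma>_def L'_def Let_def split: if_splits)
  then have g: "grad h y \<noteq> 0"
    using \<open>\<epsilon> > 0\<close> by auto
  obtain j where Ms: "Ms \<noteq> []" "L0 \<in> set Ms" and \<gamma>le: "\<gamma> \<le> max L0 L\<^sub>h"
    and j: "?\<beta> ^ j * L0 \<le> \<gamma>"
    and IH: "h y - min_value h \<le> ?q ^ j * (1 - ?p) ^ k * ?D0"
    using Suc.IH[OF st] by (auto simp: \<gamma>_def)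
  have L0\<gamma>: "L0 \<le> \<gamma>"
    using Ms by (simp add: \<gamma>_def)
  then have \<gamma>: "\<gamma> > 0"
    using L0 by simp
  have \<mu>: "\<mu> > 0"
    using PL by (simp add: PL_condition_def)
  have p: "?p < 1"
    using \<mu> L0 \<alpha> le by (intro acgm_p_less_1) auto
  have "0 \<le> L\<^sub>h\<^sup>2 / (\<alpha>\<^sup>2 * L0\<^sup>2)"
    by simp
  with acgm_Cbar_ge[OF \<mu> L0 \<alpha> le] have C: "0 \<le> ?C"
    by linarith
  have L'le: "L' \<le> L\<^sub>h"
    using local_lipschitz_estimate_le[OF \<alpha> \<gamma> g x L'_def lip] .
  have Max_Ls: "Max (set Ls) = max L' \<gamma>"
    using Ms by (simp add: Ls \<gamma>_def)
  have "\<exists>j. ?\<beta> ^ j * L0 \<le> Max (set Ls) \<and>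
      h x - min_value h \<le> ?q ^ j * (1 - ?p) ^ Suc k * ?D0"
  proof (cases "L' \<le> ?\<beta> * \<gamma>")
    case True
    have "h x - min_value h \<le> (1 - ?p) * (h y - min_value h)"
      using good_step[OF \<alpha> \<gamma> g x L'_def PL True \<gamma>le] .
    also have "\<dots> \<le> (1 - ?p) * (?q ^ j * (1 - ?p) ^ k * ?D0)"
      using IH p by (intro mult_left_mono) auto
    finally have "h x - min_value h \<le> ?q ^ j * (1 - ?p) ^ Suc k * ?D0"
      by (simp add: mult_ac)
    with j Max_Ls show ?thesis
      by (intro exI[of _ j]) auto
  next
    case False
    have "h x - min_value h \<le> (1 + ?C) * (h y - min_value h)"
      using bad_step[OF \<alpha> \<gamma> g x L'_def PL lip le L0 L0\<gamma>] .
    also have "\<dots> \<le> (1 + ?C) * (?q ^ j * (1 - ?p) ^ k * ?D0)"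
      using IH C by (intro mult_left_mono) auto
    \<comment> \<open>One factor \<open>?q\<close> times one factor \<open>1 - ?p\<close> is
      \<open>1 + ?C\<close>, so a bad step counts as a contraction plus a correction.\<close>
    also have "\<dots> = ?q ^ Suc j * (1 - ?p) ^ Suc k * ?D0"
      using p by simp
    finally have "h x - min_value h \<le> ?q ^ Suc j * (1 - ?p) ^ Suc k * ?D0" .
    moreover have "?\<beta> ^ Suc j * L0 \<le> ?\<beta> * \<gamma>"
      using j \<alpha> by simp
    \<comment> \<open>Here \<open>L'\<close> exceeds \<open>?\<beta> * \<gamma>\<close> and the new
      maximum is at least \<open>L'\<close>, so one more power of \<open>?\<beta>\<close>
      fits.\<close>
    ultimately show ?thesis
      using False Max_Ls by (intro exI[of _ "Suc j"]) auto
  qed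
  moreover have "Ls \<noteq> []" "L0 \<in> set Ls" "Max (set Ls) \<le> max L0 L\<^sub>h"
    using Ms Max_Ls L'le \<gamma>le by (auto simp: Ls)
  ultimately show ?case
    by blast
qed

text \<open>A further iterate is produced only where the gradient is large, which later rules out
  constant \<open>h\<close>.\<close>

lemma acgm_state_Suc_SomeD:
  assumes "acgm_state h x0 \<alpha> L0 \<epsilon> (Suc k) = Some s"
  shows "\<exists>y. norm (grad h y) > \<epsilon>"
  using assms by (auto split: option.splits if_splits)

lemma acgm_rate:
  fixes h :: "'a::euclidean_space \<Rightarrow> real"
  assumes PL: "PL_condition \<mu> h" and lip: "lipschitz_gradient L\<^sub>h h"
    and L0: "L0 > 0" and \<epsilon>: "\<epsilon> > 0" and \<alpha>: "\<alpha> > 1"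
    and it: "acgm_iterate h x0 \<alpha> L0 \<epsilon> (Suc k) = Some x"
  shows "h x - min_value h
    \<le> acgm_C \<mu> L\<^sub>h L0 \<alpha> * (1 - acgm_p \<mu> L\<^sub>h L0 \<alpha>) ^ Suc k * (h x0 - min_value h)"
proof -
  let ?\<beta> = "(\<alpha> + 1) / 2" and ?p = "acgm_p \<mu> L\<^sub>h L0 \<alpha>" and ?C = "acgm_Cbar \<mu> L\<^sub>h L0 \<alpha>"
  let ?q = "(1 + ?C) / (1 - ?p)" and ?M = "max L0 L\<^sub>h" and ?m = "acgm_m L\<^sub>h L0 \<alpha>"
  obtain Ls where st: "acgm_state h x0 \<alpha> L0 \<epsilon> (Suc k) = Some (x, Ls)"
    using it by (auto simp: acgm_iterate_def)
  obtain y where y: "norm (grad h y) > \<epsilon>"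
    using acgm_state_Suc_SomeD[OF st] by blast
  \<comment> \<open>By \<open>norm_grad_le\<close> a nonzero gradient forces a positive gap, and
    this supplies \<open>\<mu> \<le> L\<^sub>h\<close>.\<close>
  have "h y \<noteq> min_value h"
    using norm_grad_le[OF PL lip, of y] y \<epsilon> by auto
  then have le: "\<mu> \<le> L\<^sub>h"
    by (rule PL_constant_le[OF PL lip])
  obtain j where "?\<beta> ^ j * L0 \<le> ?M"
    and bound: "h x - min_value h \<le> ?q ^ j * (1 - ?p) ^ Suc k * (h x0 - min_value h)"
    using acgm_state_bound[OF PL lip L0 \<epsilon> \<alpha> le st] by (meson order_trans)
  then have "?\<beta> ^ j \<le> ?M / L0"
    using L0 by (simp add: le_divide_eq)
  then have "real j \<le> log ?\<beta> (?M / L0)"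
    using \<alpha> L0 by (intro le_log_of_power) auto
  \<comment> \<open>\<open>acgm_m\<close> rounds the logarithm up, so the integer \<open>j\<close>
    below the logarithm stays below it.\<close>
  then have jm: "j \<le> ?m"
    unfolding acgm_m_def by linarith
  have \<mu>: "\<mu> > 0"
    using PL by (simp add: PL_condition_def)
  have p: "0 < ?p" "?p < 1"
    using \<mu> L0 \<alpha> le by (auto intro: acgm_p_pos acgm_p_less_1)
  have "0 \<le> L\<^sub>h\<^sup>2 / (\<alpha>\<^sup>2 * L0\<^sup>2)"
    by simp
  with acgm_Cbar_ge[OF \<mu> L0 \<alpha> le] have "0 \<le> ?C"
    by linarith
  \<comment> \<open>With \<open>?q\<close> at least 1, the unknown \<open>j\<close> can be replaced
    by its bound \<open>?m\<close>.\<close>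
  then have "1 \<le> ?q"
    using p by (simp add: le_divide_eq)
  then have "?q ^ j \<le> ?q ^ ?m"
    using jm by (intro power_increasing)
  then have "?q ^ j * (1 - ?p) ^ Suc k * (h x0 - min_value h)
      \<le> ?q ^ ?m * (1 - ?p) ^ Suc k * (h x0 - min_value h)"
    using p PL_min_value_le[OF PL, of x0] by (intro mult_right_mono) auto
  with bound show ?thesis
    by (simp add: acgm_C_def power_divide)
qed

text \<open>The bound \<open>acgm_p\<close> < 1 is tied to nonconstant \<open>h\<close>, because a
  constant \<open>h\<close> leaves \<mu> unbounded; the rate bounds obtain nonconstancy from the
  existence of iterate \<open>k + 1\<close>.\<close>

theorem lemma3p2:
  fixes h :: "real ^ 'n \<Rightarrow> real" and x0 :: "real ^ 'n" and \<mu> L\<^sub>h L0 \<epsilon> :: real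
  assumes "PL_condition \<mu> h" and "lipschitz_gradient L\<^sub>h h"
    and "L0 > 0" and "\<epsilon> > 0"
  shows "(\<forall>\<alpha>>1.
            0 < acgm_p \<mu> L\<^sub>h L0 \<alpha> \<and>
            ((\<exists>y z. h y \<noteq> h z) \<longrightarrow> acgm_p \<mu> L\<^sub>h L0 \<alpha> < 1) \<and>
            (\<forall>k x. acgm_iterate h x0 \<alpha> L0 \<epsilon> (k + 1) = Some x \<longrightarrow>
               h x - min_value h
                 \<le> acgm_C \<mu> L\<^sub>h L0 \<alpha> * (1 - acgm_p \<mu> L\<^sub>h L0 \<alpha>) ^ (k + 1) * (h x0 - min_value h)))
       \<and> is_arg_min (\<lambda>\<alpha>. 1 - acgm_p \<mu> L\<^sub>h L0 \<alpha>) (\<lambda>\<alpha>. \<alpha> > 1) 2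
       \<and> (\<forall>k x. acgm_iterate h x0 2 L0 \<epsilon> (k + 1) = Some x \<longrightarrow>
               h x - min_value h
                 \<le> acgm_C \<mu> L\<^sub>h L0 2 * (1 - \<mu> / (8 * max L0 L\<^sub>h)) ^ (k + 1) * (h x0 - min_value h))"
proof (intro conjI allI impI)
  have \<mu>: "\<mu> > 0"
    using assms(1) by (simp add: PL_condition_def)
  show "0 < acgm_p \<mu> L\<^sub>h L0 \<alpha>" if "\<alpha> > 1" for \<alpha>
    using \<mu> assms(3) that by (rule acgm_p_pos)
  show "acgm_p \<mu> L\<^sub>h L0 \<alpha> < 1" if \<alpha>: "\<alpha> > 1" and "\<exists>y z. h y \<noteq> h z" for \<alpha>
  proof -
    obtain y where "h y \<noteq> min_value h"
      using \<open>\<exists>y z. h y \<noteq> h z\<close> by metis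
    then have "\<mu> \<le> L\<^sub>h"
      by (rule PL_constant_le[OF assms(1,2)])
    then show ?thesis
      using \<mu> assms(3) \<alpha> by (intro acgm_p_less_1) auto
  qed
  show "h x - min_value h
      \<le> acgm_C \<mu> L\<^sub>h L0 \<alpha> * (1 - acgm_p \<mu> L\<^sub>h L0 \<alpha>) ^ (k + 1) * (h x0 - min_value h)"
    if "\<alpha> > 1" "acgm_iterate h x0 \<alpha> L0 \<epsilon> (k + 1) = Some x" for \<alpha> k x
    using acgm_rate[OF assms that(1)] that(2) by simp
  show "is_arg_min (\<lambda>\<alpha>. 1 - acgm_p \<mu> L\<^sub>h L0 \<alpha>) (\<lambda>\<alpha>. \<alpha> > 1) 2"
    using acgm_p_le[OF \<mu> assms(3)] by (force simp: is_arg_min_linorder)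
  show "h x - min_value h
      \<le> acgm_C \<mu> L\<^sub>h L0 2 * (1 - \<mu> / (8 * max L0 L\<^sub>h)) ^ (k + 1) * (h x0 - min_value h)"
    if "acgm_iterate h x0 2 L0 \<epsilon> (k + 1) = Some x" for k x
    using acgm_rate[OF assms, of 2] that by (simp add: acgm_p_2)
qed

end
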